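(* Let $\alpha\in\mathbb R$ with $\sin\alpha>0$, and let $\phi,\widetilde\phi$ be scaling functions for dual fractional MRAs. For $j\in\mathbb Z$ and $f\in L^2(\mathbb R)$ set $$\mathcal P_{\alpha,j}f=\sum_{k\in\mathbb Z}\langle f,\widetilde\phi_{\alpha,j,k}\rangle\phi_{\alpha,j,k},\qquad \widetilde{\mathcal P}_{\alpha,j}f=\sum_{k\in\mathbb Z}\langle f,\phi_{\alpha,j,k}\rangle\widetilde\phi_{\alpha,j,k}.$$ Then the operators $\mathcal P_{\alpha,j}$ and $\widetilde{\mathcal P}_{\alpha,j}$, $j\in\mathbb Z$, are uniformly bounded on $L^2(\mathbb R)$: there is a constant $C>0$ such that $\|\mathcal P_{\alpha,j}f\|_2\le C\|f\|_2$ and $\|\widetilde{\mathcal P}_{\alpha,j}f\|_2\le C\|f\|_2$ for all $j\in\mathbb Z$ and $f\in L^2(\mathbb R)$.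
   Context: For $f\in L^2(\mathbb R)$ and $m,n\in\mathbb Z$ put $f_{\alpha,m,n}(t)=2^{m/2}f(2^mt-n)\exp\{-\tfrac{i}{2}[t^2-(2^{-m}n)^2-(2^mt-n)^2]\cot\alpha\}$; this defines $\phi_{\alpha,m,n},\widetilde\phi_{\alpha,m,n}$. A countable collection $\{g_n\}$ in $L^2(\mathbb R)$ is linearly independent if $\sum_n a[n]g_n=0$ in $L^2(\mathbb R)$ with $a\in\ell^2$ implies $a=0$. A collection $\{g_n\}$ in a closed subspace $\mathcal H$ of $L^2(\mathbb R)$ is a Riesz basis of $\mathcal H$ if it is linearly independent and there are $A,B>0$ with $A\|f\|_2^2\le\sum_n|\langle f,g_n\rangle|^2\le B\|f\|_2^2$ for all $f\in\mathcal H$. A fractional MRA with scaling function $\phi$ is a sequence of closed subspaces $\{V_k^\alpha\}_{k\in\mathbb Z}$ of $L^2(\mathbb R)$ such that: (i) $V_k^\alpha\subseteq V_{k+1}^\alpha$; (ii) $\bigcup_kV_k^\alpha$ is dense in $L^2(\mathbb R)$; (iii) $\bigcap_kV_k^\alpha=\{0\}$; (iv) $f(t)\in V_k^\alpha$ iff $f(2t)e^{\frac{i}{2}[(2t)^2-t^2]\cot\alpha}\in V_{k+1}^\alpha$; (v) $\phi\in V_0^\alpha$ and $\{\phi_{\alpha,0,n}:n\in\mathbb Z\}$ is a Riesz basis of $V_0^\alpha$. Two fractional MRAs with scaling functions $\phi,\widetilde\phi$ are dual if $\langle\phi_{\alpha,0,n},\widetilde\phi_{\alpha,0,m}\rangle=\delta_{n,m}$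 for all $n,m\in\mathbb Z$. *)

theory Defs
  imports "HOL-Analysis.Analysis"
begin

section \<open>The space of square-integrable functions\<close>

text \<open>
  Elements of \<open>L\<^sup>2(\<real>)\<close> are represented by Borel functions; equality in \<open>L\<^sup>2(\<real>)\<close> is equality
  almost everywhere with respect to Lebesgue measure. The inner product is linear in its first
  argument.
\<close>

definition L2 :: "(real \<Rightarrow> complex) set" where
  "L2 = {f. f \<in> borel_measurable borel \<and> integrable lborel (\<lambda>t. (cmod (f t))\<^sup>2)}"

definition L2_inner :: "(real \<Rightarrow> complex) \<Rightarrow> (real \<Rightarrow> complex) \<Rightarrow> complex" where
  "L2_inner f g = (LINT t|lborel. f t * cnj (g t))"

definition L2_norm :: "(real \<Rightarrow> complex) \<Rightarrow> real" where
  "L2_norm f = sqrt (LINT t|lborel. (cmod (f t))\<^sup>2)"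

text \<open>
  Unconditional convergence in \<open>L\<^sup>2(\<real>)\<close>, the analogue of \<open>has_sum\<close>. The sum is only determined
  almost everywhere, so \<open>L2_sum\<close> picks one representative of it.
\<close>

definition L2_has_sum :: "('i \<Rightarrow> real \<Rightarrow> complex) \<Rightarrow> (real \<Rightarrow> complex) \<Rightarrow> bool" where
  "L2_has_sum u s \<longleftrightarrow> s \<in> L2 \<and>
     ((\<lambda>F. L2_norm (\<lambda>t. (\<Sum>i\<in>F. u i t) - s t)) \<longlongrightarrow> 0) (finite_subsets_at_top UNIV)"

definition L2_sum :: "('i \<Rightarrow> real \<Rightarrow> complex) \<Rightarrow> real \<Rightarrow> complex" where
  "L2_sum u = (SOME s. L2_has_sum u s)"

text \<open>
  The closure condition, applied to constant sequences, makes \<open>V\<close> saturated under almost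
  everywhere equality, so \<open>V\<close> does describe a set of elements of \<open>L\<^sup>2(\<real>)\<close>.
\<close>

definition closed_L2_subspace :: "(real \<Rightarrow> complex) set \<Rightarrow> bool" where
  "closed_L2_subspace V \<longleftrightarrow>
     V \<subseteq> L2 \<and> (\<lambda>t. 0) \<in> V \<and>
     (\<forall>f\<in>V. \<forall>g\<in>V. (\<lambda>t. f t + g t) \<in> V) \<and>
     (\<forall>c. \<forall>f\<in>V. (\<lambda>t. c * f t) \<in> V) \<and>
     (\<forall>u. \<forall>f\<in>L2. (\<forall>n. u n \<in> V) \<and> (\<lambda>n::nat. L2_norm (\<lambda>t. u n t - f t)) \<longlonglongrightarrow> 0 \<longrightarrow> f \<in> V)"


section \<open>Riesz bases\<close>

definition L2_independent :: "('i::countable \<Rightarrow> real \<Rightarrow> complex) \<Rightarrow> bool" where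
  "L2_independent g \<longleftrightarrow>
     (\<forall>a. (\<lambda>n. (cmod (a n))\<^sup>2) summable_on UNIV \<and> L2_has_sum (\<lambda>n t. a n * g n t) (\<lambda>t. 0)
        \<longrightarrow> (\<forall>n. a n = 0))"

text \<open>
  Summability is stated separately because \<open>infsum\<close> is \<open>0\<close> for series that do not converge.
\<close>

definition Riesz_basis :: "('i::countable \<Rightarrow> real \<Rightarrow> complex) \<Rightarrow> (real \<Rightarrow> complex) set \<Rightarrow> bool" where
  "Riesz_basis g H \<longleftrightarrow>
     (\<forall>n. g n \<in> H) \<and> L2_independent g \<and>
     (\<exists>A>0. \<exists>B>0. \<forall>f\<in>H.
        (\<lambda>n. (cmod (L2_inner f (g n)))\<^sup>2) summable_on UNIV \<and>
        A * (L2_norm f)\<^sup>2 \<le> (\<Sum>\<^sub>\<infinity>n. (cmod (L2_inner f (g n)))\<^sup>2) \<and>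
        (\<Sum>\<^sub>\<infinity>n. (cmod (L2_inner f (g n)))\<^sup>2) \<le> B * (L2_norm f)\<^sup>2)"


section \<open>Fractional multiresolution analyses\<close>

definition frac_wavelet :: "real \<Rightarrow> (real \<Rightarrow> complex) \<Rightarrow> int \<Rightarrow> int \<Rightarrow> real \<Rightarrow> complex" where
  "frac_wavelet \<alpha> f m n t =
     of_real (2 powr (of_int m / 2)) * f (2 powi m * t - of_int n) *
     exp (- (\<i> / 2) * of_real ((t\<^sup>2 - (2 powi (- m) * of_int n)\<^sup>2
                                  - (2 powi m * t - of_int n)\<^sup>2) * cot \<alpha>))"

definition fractional_MRA ::
    "real \<Rightarrow> (int \<Rightarrow> (real \<Rightarrow> complex) set) \<Rightarrow> (real \<Rightarrow> complex) \<Rightarrow> bool" where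
  "fractional_MRA \<alpha> V \<phi> \<longleftrightarrow>
     (\<forall>k. closed_L2_subspace (V k)) \<and>
     (\<forall>k. V k \<subseteq> V (k + 1)) \<and>
     (\<forall>f\<in>L2. \<forall>\<epsilon>>0. \<exists>g\<in>(\<Union>k. V k). L2_norm (\<lambda>t. f t - g t) < \<epsilon>) \<and>
     (\<Inter>k. V k) = {f \<in> L2. AE t in lborel. f t = 0} \<and>
     (\<forall>k. \<forall>f\<in>L2. f \<in> V k \<longleftrightarrow>
        (\<lambda>t. f (2 * t) * exp ((\<i> / 2) * of_real (((2 * t)\<^sup>2 - t\<^sup>2) * cot \<alpha>))) \<in> V (k + 1)) \<and>
     \<phi> \<in> V 0 \<and> Riesz_basis (\<lambda>n. frac_wavelet \<alpha> \<phi> 0 n) (V 0)"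

definition dual_fractional_MRAs ::
    "real \<Rightarrow> (int \<Rightarrow> (real \<Rightarrow> complex) set) \<Rightarrow> (real \<Rightarrow> complex) \<Rightarrow>
     (int \<Rightarrow> (real \<Rightarrow> complex) set) \<Rightarrow> (real \<Rightarrow> complex) \<Rightarrow> bool" where
  "dual_fractional_MRAs \<alpha> V \<phi> V' \<phi>' \<longleftrightarrow>
     fractional_MRA \<alpha> V \<phi> \<and> fractional_MRA \<alpha> V' \<phi>' \<and>
     (\<forall>n m. L2_inner (frac_wavelet \<alpha> \<phi> 0 n) (frac_wavelet \<alpha> \<phi>' 0 m) = (if n = m then 1 else 0))"

text \<open>
  The operator \<open>\<P>\<^sub>\<alpha>\<^sub>,\<^sub>j\<close> is \<open>frac_proj \<alpha> \<phi> \<phi>' j\<close>; its companion with the roles of the two scaling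
  functions exchanged is \<open>frac_proj \<alpha> \<phi>' \<phi> j\<close>. The series is kept as a separate constant so that
  its convergence can be asserted.
\<close>

definition frac_proj_term ::
    "real \<Rightarrow> (real \<Rightarrow> complex) \<Rightarrow> (real \<Rightarrow> complex) \<Rightarrow> int \<Rightarrow> (real \<Rightarrow> complex) \<Rightarrow>
     int \<Rightarrow> real \<Rightarrow> complex" where
  "frac_proj_term \<alpha> \<phi> \<phi>' j f k t =
     L2_inner f (frac_wavelet \<alpha> \<phi>' j k) * frac_wavelet \<alpha> \<phi> j k t"

definition frac_proj ::
    "real \<Rightarrow> (real \<Rightarrow> complex) \<Rightarrow> (real \<Rightarrow> complex) \<Rightarrow> int \<Rightarrow> (real \<Rightarrow> complex) \<Rightarrow>
     real \<Rightarrow> complex" where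
  "frac_proj \<alpha> \<phi> \<phi>' j f = L2_sum (frac_proj_term \<alpha> \<phi> \<phi>' j f)"

end

theory Submission
  imports Defs
begin

text \<open>
  The upper Riesz bound on \<open>V\<^sub>0\<close>, applied to
  \<open>h = \<Sum> a\<^sub>n \<phi>\<^sub>n\<close>, bounds \<open>\<parallel>h\<parallel>\<^sup>2\<close> by \<open>B \<Sum> \<bar>a\<^sub>n\<bar>\<^sup>2\<close>. Up to unimodular
  factors, \<open>\<phi>\<^sub>\<alpha>\<^sub>,\<^sub>j\<^sub>,\<^sub>n\<close> is the image of \<open>\<phi>\<^sub>\<alpha>\<^sub>,\<^sub>0\<^sub>,\<^sub>n\<close> under a unitary chirped dilation, so this
  synthesis bound holds at every scale with the same \<open>B\<close>. Pairing \<open>h\<close> with an arbitrary \<open>f\<close>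
  turns it into Bessel's inequality on all of \<open>L\<^sup>2(\<real>)\<close>, not only on \<open>V\<^sub>0\<close>; composing the
  analysis bound of one family with the synthesis bound of the other bounds the operators.

  The weighted AM-GM inequality replaces Cauchy-Schwarz and Minkowski throughout, at the price of a
  factor of \<open>2\<close> in the constant.
\<close>

section \<open>Vector space operations, norm and inner product on \<open>L2\<close>\<close>

lemma L2_measurable: "f \<in> L2 \<Longrightarrow> f \<in> borel_measurable borel"
  and L2_integrable: "f \<in> L2 \<Longrightarrow> integrable lborel (\<lambda>t. (cmod (f t))\<^sup>2)"
  by (auto simp: L2_def)

lemma L2_norm_nonneg [simp]: "L2_norm f \<ge> 0"
  by (simp add: L2_norm_def)

lemma L2_norm_sq: "(L2_norm f)\<^sup>2 = (LINT t|lborel. (cmod (f t))\<^sup>2)"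
  by (simp add: L2_norm_def)

lemma L2_scale: "f \<in> L2 \<Longrightarrow> (\<lambda>t. c * f t) \<in> L2"
  by (auto simp: L2_def norm_mult power_mult_distrib)

lemma cmod_add_sq_le: "(cmod (x + y))\<^sup>2 \<le> 2 * (cmod x)\<^sup>2 + 2 * (cmod y)\<^sup>2"
proof -
  have "(cmod (x + y))\<^sup>2 \<le> (cmod x + cmod y)\<^sup>2"
    by (simp add: norm_triangle_ineq power_mono)
  also have "\<dots> \<le> 2 * (cmod x)\<^sup>2 + 2 * (cmod y)\<^sup>2"
    using zero_le_power2 [of "cmod x - cmod y"] by (simp add: power2_eq_square algebra_simps)
  finally show ?thesis .
qed

lemma L2_add:
  assumes f: "f \<in> L2" and g: "g \<in> L2"
  shows "(\<lambda>t. f t + g t) \<in> L2"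
proof -
  note [measurable] = L2_measurable [OF f] L2_measurable [OF g]
  have "integrable lborel (\<lambda>t. (cmod (f t + g t))\<^sup>2)"
  proof (rule Bochner_Integration.integrable_bound)
    show "integrable lborel (\<lambda>t. 2 * (cmod (f t))\<^sup>2 + 2 * (cmod (g t))\<^sup>2)"
      using L2_integrable [OF f] L2_integrable [OF g] by auto
  qed (auto intro!: cmod_add_sq_le)
  then show ?thesis
    by (auto simp: L2_def)
qed

lemma L2_diff: "f \<in> L2 \<Longrightarrow> g \<in> L2 \<Longrightarrow> (\<lambda>t. f t - g t) \<in> L2"
  using L2_add [of f "\<lambda>t. - 1 * g t"] L2_scale [of g "- 1"] by simp

lemma L2_sum_mem:
  assumes "finite F" "\<And>i. i \<in> F \<Longrightarrow> u i \<in> L2"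
  shows "(\<lambda>t. \<Sum>i\<in>F. u i t) \<in> L2"
  using assms
proof (induction F rule: finite_induct)
  case empty
  show ?case by (simp add: L2_def)
next
  case (insert i F)
  then show ?case using L2_add [of "u i" "\<lambda>t. \<Sum>i\<in>F. u i t"] by simp
qed

lemma L2_norm_sq_add_le:
  assumes f: "f \<in> L2" and g: "g \<in> L2"
  shows "(L2_norm (\<lambda>t. f t + g t))\<^sup>2 \<le> 2 * (L2_norm f)\<^sup>2 + 2 * (L2_norm g)\<^sup>2"
proof -
  have "(L2_norm (\<lambda>t. f t + g t))\<^sup>2 \<le> (LINT t|lborel. 2 * (cmod (f t))\<^sup>2 + 2 * (cmod (g t))\<^sup>2)"
    unfolding L2_norm_sq
    using L2_integrable [OF L2_add [OF f g]] L2_integrable [OF f] L2_integrable [OF g]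
    by (intro integral_mono) (auto intro: cmod_add_sq_le)
  also have "\<dots> = 2 * (L2_norm f)\<^sup>2 + 2 * (L2_norm g)\<^sup>2"
    using L2_integrable [OF f] L2_integrable [OF g] by (simp add: L2_norm_sq)
  finally show ?thesis .
qed

lemma L2_norm_minus_commute: "L2_norm (\<lambda>t. f t - g t) = L2_norm (\<lambda>t. g t - f t)"
  by (simp add: L2_norm_def norm_minus_commute)

text \<open>Expand the square of \<open>c * x - y\<close> and divide by \<open>c\<close>. The free
  weight gives this the strength of Cauchy-Schwarz: for a suitable \<open>c\<close> the quantity
  being estimated returns on the right with factor 1/2 and can be absorbed.\<close>

lemma weighted_amgm:
  fixes x y c :: real
  assumes "c > 0"
  shows "x * y \<le> (c * x\<^sup>2 + y\<^sup>2 / c) / 2"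
proof -
  have "0 \<le> (c * x - y)\<^sup>2 / c" using assms by simp
  also have "\<dots> = c * x\<^sup>2 + y\<^sup>2 / c - 2 * (x * y)"
    using assms by (simp add: power2_eq_square field_simps)
  finally show ?thesis by simp
qed

lemma L2_inner_integrable:
  assumes f: "f \<in> L2" and g: "g \<in> L2"
  shows "integrable lborel (\<lambda>t. f t * cnj (g t))"
proof (rule Bochner_Integration.integrable_bound)
  note [measurable] = L2_measurable [OF f] L2_measurable [OF g]
  show "integrable lborel (\<lambda>t. (1 * (cmod (f t))\<^sup>2 + (cmod (g t))\<^sup>2 / 1) / 2)"
    using L2_integrable [OF f] L2_integrable [OF g] by auto
  have "(\<lambda>t. cnj (g t)) \<in> borel_measurable borel"
    by (rule borel_measurable_continuous_on [OF _ L2_measurable [OF g]]) (intro continuous_intros)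
  then show "(\<lambda>t. f t * cnj (g t)) \<in> borel_measurable lborel"
    by simp
  show "AE t in lborel. norm (f t * cnj (g t)) \<le> norm ((1 * (cmod (f t))\<^sup>2 + (cmod (g t))\<^sup>2 / 1) / 2)"
    unfolding norm_mult complex_mod_cnj
    by (intro AE_I2 order_trans [OF weighted_amgm [where c=1]]) auto
qed

lemma L2_inner_bound:
  assumes f: "f \<in> L2" and g: "g \<in> L2" and c: "c > 0"
  shows "cmod (L2_inner f g) \<le> (c * (L2_norm f)\<^sup>2 + (L2_norm g)\<^sup>2 / c) / 2"
proof -
  have "cmod (L2_inner f g) \<le> (LINT t|lborel. cmod (f t * cnj (g t)))"
    unfolding L2_inner_def by (rule integral_norm_bound)
  also have "\<dots> \<le> (LINT t|lborel. (c * (cmod (f t))\<^sup>2 + (cmod (g t))\<^sup>2 / c) / 2)"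
  proof (rule integral_mono)
    show "integrable lborel (\<lambda>t. cmod (f t * cnj (g t)))"
      by (intro integrable_norm L2_inner_integrable f g)
    show "integrable lborel (\<lambda>t. (c * (cmod (f t))\<^sup>2 + (cmod (g t))\<^sup>2 / c) / 2)"
      using L2_integrable [OF f] L2_integrable [OF g] by simp
    show "cmod (f t * cnj (g t)) \<le> (c * (cmod (f t))\<^sup>2 + (cmod (g t))\<^sup>2 / c) / 2" for t
      unfolding norm_mult complex_mod_cnj by (rule weighted_amgm [OF c])
  qed
  also have "\<dots> = (c * (L2_norm f)\<^sup>2 + (L2_norm g)\<^sup>2 / c) / 2"
    using L2_integrable [OF f] L2_integrable [OF g] by (simp add: L2_norm_sq)
  finally show ?thesis .
qed

lemma L2_inner_sum_right:
  assumes "finite F" "f \<in> L2" "\<And>n. n \<in> F \<Longrightarrow> g n \<in> L2"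
  shows "L2_inner f (\<lambda>t. \<Sum>n\<in>F. a n * g n t) = (\<Sum>n\<in>F. cnj (a n) * L2_inner f (g n))"
proof -
  have "L2_inner f (\<lambda>t. \<Sum>n\<in>F. a n * g n t) =
      (LINT t|lborel. (\<Sum>n\<in>F. cnj (a n) * (f t * cnj (g n t))))"
    unfolding L2_inner_def by (simp add: sum_distrib_left mult_ac)
  also have "\<dots> = (\<Sum>n\<in>F. cnj (a n) * L2_inner f (g n))"
    unfolding L2_inner_def using assms
    by (subst Bochner_Integration.integral_sum)
      (auto intro!: integrable_mult_right L2_inner_integrable)
  finally show ?thesis .
qed

lemma L2_inner_self: "L2_inner f f = of_real ((L2_norm f)\<^sup>2)"
  unfolding L2_inner_def L2_norm_sq complex_norm_square [symmetric] integral_complex_of_real ..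


subsection \<open>Completeness along geometrically Cauchy sequences\<close>

text \<open>The Riesz-Fischer argument for a sequence whose Cauchy rate is prescribed: the
  increments are so small that the telescoping series converges almost everywhere, and Fatou's lemma
  carries the Cauchy estimate over to the pointwise limit.\<close>

lemma L2_geometric_Cauchy_limit:
  fixes u :: "nat \<Rightarrow> real \<Rightarrow> complex"
  assumes u: "\<And>k. u k \<in> L2"
    and cauchy: "\<And>k m. k \<le> m \<Longrightarrow> (L2_norm (\<lambda>t. u m t - u k t))\<^sup>2 \<le> C * (1 / 4) ^ k"
  shows "\<exists>s\<in>L2. \<forall>k. (L2_norm (\<lambda>t. u k t - s t))\<^sup>2 \<le> C * (1 / 4) ^ k"
proof -
  note [measurable] = L2_measurable [OF u]
  have nn: "(\<integral>\<^sup>+ t. ennreal ((cmod (u m t - u k t))\<^sup>2) \<partial>lborel) \<le> ennreal (C * (1 / 4) ^ k)"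
    if "k \<le> m" for k m
    using cauchy [OF that] L2_integrable [OF L2_diff [OF u u]]
    by (subst nn_integral_eq_integral) (auto simp: L2_norm_sq intro: ennreal_leI)
  have C: "C \<ge> 0"
    using cauchy [of 0 0] by (simp add: order_trans [OF zero_le_power2])
  txt \<open>
    The weights \<open>2 ^ k\<close> keep \<open>\<Sum>k. w k t\<close> integrable, and by AM-GM its finiteness at \<open>t\<close> forces
    absolute convergence of the telescoping series at \<open>t\<close>.
  \<close>
  define w where "w k t = 2 ^ k * (cmod (u (Suc k) t - u k t))\<^sup>2" for k t
  have w_meas [measurable]: "w k \<in> borel_measurable borel" for k
    unfolding w_def by measurable
  have w_nonneg: "w k t \<ge> 0" for k t
    by (simp add: w_def)
  have wint: "(\<integral>\<^sup>+ t. ennreal (w k t) \<partial>lborel) \<le> ennreal (C * (1 / 2) ^ k)" for k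
  proof -
    have "(\<integral>\<^sup>+ t. ennreal (w k t) \<partial>lborel) =
        ennreal (2 ^ k) * (\<integral>\<^sup>+ t. ennreal ((cmod (u (Suc k) t - u k t))\<^sup>2) \<partial>lborel)"
      unfolding w_def by (subst nn_integral_cmult [symmetric]) (auto simp: ennreal_mult)
    also have "\<dots> \<le> ennreal (2 ^ k) * ennreal (C * (1 / 4) ^ k)"
      by (intro mult_left_mono nn) auto
    also have "\<dots> = ennreal (2 ^ k * (C * (1 / 4) ^ k))"
      using C by (simp add: ennreal_mult)
    also have "2 ^ k * (C * (1 / 4) ^ k) = C * (2 * (1 / 4)) ^ k"
      by (simp only: power_mult_distrib mult_ac)
    finally show ?thesis by simp
  qed
  have "(\<integral>\<^sup>+ t. (\<Sum>k. ennreal (w k t)) \<partial>lborel) = (\<Sum>k. \<integral>\<^sup>+ t. ennreal (w k t) \<partial>lborel)"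
    by (intro nn_integral_suminf) measurable
  also have "\<dots> \<le> (\<Sum>k. ennreal (C * (1 / 2) ^ k))"
    by (intro suminf_le wint) auto
  also have "\<dots> < \<infinity>"
    using C by (subst suminf_ennreal2) (auto intro!: summable_mult summable_geometric)
  finally have "AE t in lborel. (\<Sum>k. ennreal (w k t)) \<noteq> \<infinity>"
    by (intro nn_integral_PInf_AE) auto
  then have conv: "AE t in lborel. (\<lambda>k. u k t) \<longlonglongrightarrow> lim (\<lambda>k. u k t)"
  proof eventually_elim
    case (elim t)
    then have "summable (\<lambda>k. w k t)"
      by (intro summable_suminf_not_top) (auto simp: w_nonneg)
    then have sm: "summable (\<lambda>k. (w k t + (1 / 2) ^ k) / 2)"
      by (intro summable_divide summable_add) (auto intro: summable_geometric)
    \<comment> \<open>AM-GM with weight \<open>2 ^ k\<close> and second factor 1 splits each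
      increment into \<open>w k t\<close> and a geometric term, both summable at
      \<open>t\<close>.\<close>
    have "cmod (u (Suc k) t - u k t) \<le> (w k t + (1 / 2) ^ k) / 2" for k
      using weighted_amgm [of "2 ^ k" "cmod (u (Suc k) t - u k t)" 1]
      by (simp add: w_def power_one_over)
    then have "summable (\<lambda>k. u (Suc k) t - u k t)"
      by (intro summable_comparison_test' [OF sm, of 0]) auto
    then have "convergent (\<lambda>n. \<Sum>k<n. u (Suc k) t - u k t)"
      by (simp add: summable_iff_convergent)
    then have "convergent (\<lambda>n. (u n t - u 0 t) + u 0 t)"
      by (intro convergent_add convergent_const) (simp only: sum_lessThan_telescope [of "\<lambda>k. u k t"])
    then show ?case
      by (simp add: convergent_LIMSEQ_iff)
  qed
  \<comment> \<open>On the null set where the sequence diverges, \<open>lim\<close> is an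
    unspecified value; this does not affect the integrals below.\<close>
  define s where "s t = lim (\<lambda>k. u k t)" for t
  have [measurable]: "s \<in> borel_measurable borel"
    unfolding s_def by (intro borel_measurable_lim_metric) measurable
  \<comment> \<open>Fix \<open>k\<close> and let \<open>m\<close> tend to infinity in the Cauchy
    estimate: the integrand converges almost everywhere, so Fatou's lemma keeps the same
    bound.\<close>
  have bound: "(\<integral>\<^sup>+ t. ennreal ((cmod (u k t - s t))\<^sup>2) \<partial>lborel) \<le> ennreal (C * (1 / 4) ^ k)" for k
  proof -
    have "(\<integral>\<^sup>+ t. ennreal ((cmod (u k t - s t))\<^sup>2) \<partial>lborel) =
        (\<integral>\<^sup>+ t. liminf (\<lambda>m. ennreal ((cmod (u m t - u k t))\<^sup>2)) \<partial>lborel)"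
    proof (rule nn_integral_cong_AE)
      show "AE t in lborel. ennreal ((cmod (u k t - s t))\<^sup>2) =
          liminf (\<lambda>m. ennreal ((cmod (u m t - u k t))\<^sup>2))"
        using conv
      proof eventually_elim
        case (elim t)
        then have "(\<lambda>m. ennreal ((cmod (u m t - u k t))\<^sup>2)) \<longlonglongrightarrow> ennreal ((cmod (s t - u k t))\<^sup>2)"
          unfolding s_def by (intro tendsto_intros tendsto_ennrealI)
        then show ?case
          by (metis lim_imp_Liminf norm_minus_commute trivial_limit_sequentially)
      qed
    qed
    also have "\<dots> \<le> liminf (\<lambda>m. \<integral>\<^sup>+ t. ennreal ((cmod (u m t - u k t))\<^sup>2) \<partial>lborel)"
      by (intro nn_integral_liminf) measurable
    also have "\<dots> \<le> liminf (\<lambda>m. ennreal (C * (1 / 4) ^ k))"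
      by (intro Liminf_mono eventually_sequentiallyI [of k] nn)
    also have "\<dots> = ennreal (C * (1 / 4) ^ k)"
      by (simp add: Liminf_const)
    finally show ?thesis .
  qed
  have diff: "(\<lambda>t. u k t - s t) \<in> L2" for k
  proof -
    have "integrable lborel (\<lambda>t. (cmod (u k t - s t))\<^sup>2)"
      using order_le_less_trans [OF bound [of k]] by (intro integrableI_bounded) auto
    then show ?thesis
      by (simp add: L2_def)
  qed
  show ?thesis
  proof (intro bexI allI)
    \<comment> \<open>Write \<open>s\<close> as \<open>u 0\<close> minus the difference
      \<open>u 0 - s\<close>, both already in \<open>L2\<close>.\<close>
    show "s \<in> L2"
      using L2_diff [OF u [of 0] diff [of 0]] by simp
    show "(L2_norm (\<lambda>t. u k t - s t))\<^sup>2 \<le> C * (1 / 4) ^ k" for k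
      using bound [of k] C L2_integrable [OF diff [of k]]
      by (subst (asm) nn_integral_eq_integral) (auto simp: L2_norm_sq)
  qed
qed


subsection \<open>Bessel families\<close>

text \<open>The synthesis map from coefficient sequences to functions has norm at most
  \<open>sqrt B\<close>. Testing it on finite sums only avoids presupposing convergence.\<close>

definition synthesis_bound :: "real \<Rightarrow> ('i \<Rightarrow> real \<Rightarrow> complex) \<Rightarrow> bool" where
  "synthesis_bound B g \<longleftrightarrow> B > 0 \<and> (\<forall>n. g n \<in> L2) \<and>
     (\<forall>F a. finite F \<longrightarrow> (L2_norm (\<lambda>t. \<Sum>n\<in>F. a n * g n t))\<^sup>2 \<le> B * (\<Sum>n\<in>F. (cmod (a n))\<^sup>2))"

lemma synthesis_bound_le:
  assumes "synthesis_bound B g" "finite F"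
  shows "(L2_norm (\<lambda>t. \<Sum>n\<in>F. a n * g n t))\<^sup>2 \<le> B * (\<Sum>n\<in>F. (cmod (a n))\<^sup>2)"
  using assms by (simp add: synthesis_bound_def)

text \<open>A finite combination \<open>h\<close> lies in \<open>H\<close>, so the upper Riesz bound
  controls its inner products with the \<open>g n\<close>. Expanding the inner product of
  \<open>h\<close> with itself brings in exactly these numbers.\<close>

lemma Riesz_basis_synthesis_bound:
  assumes rb: "Riesz_basis g H" and H: "closed_L2_subspace H"
  obtains B where "synthesis_bound B g"
proof -
  obtain B where B: "B > 0"
    and sm: "\<And>f. f \<in> H \<Longrightarrow> (\<lambda>n. (cmod (L2_inner f (g n)))\<^sup>2) summable_on UNIV"
    and le: "\<And>f. f \<in> H \<Longrightarrow> (\<Sum>\<^sub>\<infinity>n. (cmod (L2_inner f (g n)))\<^sup>2) \<le> B * (L2_norm f)\<^sup>2"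
    using rb unfolding Riesz_basis_def by blast
  have gH: "g n \<in> H" for n
    using rb by (simp add: Riesz_basis_def)
  have HL2: "H \<subseteq> L2"
    using H by (simp add: closed_L2_subspace_def)
  have "(L2_norm (\<lambda>t. \<Sum>n\<in>F. a n * g n t))\<^sup>2 \<le> B * (\<Sum>n\<in>F. (cmod (a n))\<^sup>2)"
    if F: "finite F" for F a
  proof -
    define h where "h t = (\<Sum>n\<in>F. a n * g n t)" for t
    have "(\<lambda>t. \<Sum>n\<in>F. a n * g n t) \<in> H"
      using F
    proof (induction F rule: finite_induct)
      case empty
      then show ?case using H by (simp add: closed_L2_subspace_def)
    next
      case (insert n F)
      then show ?case using H gH [of n] by (simp add: closed_L2_subspace_def)
    qed
    then have h: "h \<in> H"
      by (simp add: h_def [abs_def])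
    have "(L2_norm h)\<^sup>2 = cmod (L2_inner h h)"
      by (simp add: L2_inner_self norm_power)
    also have "\<dots> = cmod (L2_inner h (\<lambda>t. \<Sum>n\<in>F. a n * g n t))"
      by (simp add: h_def [abs_def])
    also have "\<dots> = cmod (\<Sum>n\<in>F. cnj (a n) * L2_inner h (g n))"
      using F h gH HL2 by (subst L2_inner_sum_right) auto
    also have "\<dots> \<le> (\<Sum>n\<in>F. cmod (a n) * cmod (L2_inner h (g n)))"
      by (rule order_trans [OF norm_sum]) (simp add: norm_mult)
    \<comment> \<open>With weight \<open>B\<close>, the upper Riesz bound turns the second summand
      into half the squared norm of \<open>h\<close>, which is absorbed on the left.\<close>
    also have "\<dots> \<le> (\<Sum>n\<in>F. (B * (cmod (a n))\<^sup>2 + (cmod (L2_inner h (g n)))\<^sup>2 / B) / 2)"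
      by (intro sum_mono weighted_amgm B)
    also have "\<dots> = (B * (\<Sum>n\<in>F. (cmod (a n))\<^sup>2) + (\<Sum>n\<in>F. (cmod (L2_inner h (g n)))\<^sup>2) / B) / 2"
      by (simp add: sum.distrib sum_distrib_left sum_divide_distrib add_divide_distrib)
    also have "(\<Sum>n\<in>F. (cmod (L2_inner h (g n)))\<^sup>2) \<le> B * (L2_norm h)\<^sup>2"
      using finite_sum_le_infsum [OF sm [OF h] F] le [OF h] by simp
    finally have "(L2_norm h)\<^sup>2 \<le> B * (\<Sum>n\<in>F. (cmod (a n))\<^sup>2)"
      using B by (simp add: divide_right_mono field_simps)
    then show ?thesis
      by (simp add: h_def [abs_def])
  qed
  then show thesis
    using that [of B] B gH HL2 by (auto simp: synthesis_bound_def)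
qed

text \<open>The analysis map is the adjoint of the synthesis map and inherits its bound. As
  \<open>f\<close> is an arbitrary element of \<open>L2\<close>, this is Bessel's inequality on the
  whole space.\<close>

lemma synthesis_bound_analysis:
  assumes sb: "synthesis_bound B g" and f: "f \<in> L2" and F: "finite F"
  shows "(\<Sum>n\<in>F. (cmod (L2_inner f (g n)))\<^sup>2) \<le> B * (L2_norm f)\<^sup>2"
proof -
  have B: "B > 0" and g: "\<And>n. g n \<in> L2"
    using sb by (auto simp: synthesis_bound_def)
  let ?S = "\<Sum>n\<in>F. (cmod (L2_inner f (g n)))\<^sup>2"
  \<comment> \<open>Taking the inner products themselves as coefficients makes the pairing of
    \<open>f\<close> with \<open>?h\<close> equal to \<open>?S\<close>; the synthesis bound then
    returns \<open>?S\<close> on the right with factor 1/2.\<close>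
  let ?h = "\<lambda>t. \<Sum>n\<in>F. L2_inner f (g n) * g n t"
  have "?S = cmod (of_real ?S)"
    by (simp only: norm_of_real) (simp add: sum_nonneg)
  also have "of_real ?S = L2_inner f ?h"
    using F f g unfolding of_real_sum complex_norm_square
    by (simp add: L2_inner_sum_right mult.commute [of _ "cnj _"])
  also have "cmod \<dots> \<le> (B * (L2_norm f)\<^sup>2 + (L2_norm ?h)\<^sup>2 / B) / 2"
    using F f g by (intro L2_inner_bound L2_sum_mem L2_scale B) auto
  also have "(L2_norm ?h)\<^sup>2 \<le> B * ?S"
    using sb F by (simp add: synthesis_bound_def)
  finally show ?thesis
    using B by (simp add: divide_right_mono field_simps)
qed

text \<open>The synthesis bound turns small tails of the square-summable coefficients into small
  \<open>L2\<close> norms of partial sums. A limit is built along one increasing sequence of finite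
  sets and then shown to be the limit over all finite sets.\<close>

lemma synthesis_bound_has_sum:
  fixes g :: "'i \<Rightarrow> real \<Rightarrow> complex"
  assumes sb: "synthesis_bound B g" and a: "(\<lambda>n. (cmod (a n))\<^sup>2) summable_on UNIV"
  obtains s where "L2_has_sum (\<lambda>n t. a n * g n t) s"
proof -
  have B: "B > 0" and g: "\<And>n. g n \<in> L2"
    using sb by (auto simp: synthesis_bound_def)
  define S where "S F t = (\<Sum>n\<in>F. a n * g n t)" for F t
  have S_mem: "S F \<in> L2" if "finite F" for F
    unfolding S_def [abs_def] using that g by (intro L2_sum_mem L2_scale)
  \<comment> \<open>Once a finite set carries all but \<open>(1 / 4) ^ k\<close> of the total mass,
    any finite set disjoint from it carries at most that much.\<close>
  have "\<exists>E. finite E \<and> (\<forall>F. finite F \<and> F \<inter> E = {} \<longrightarrow> (\<Sum>n\<in>F. (cmod (a n))\<^sup>2) \<le> (1 / 4) ^ k)"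
    for k :: nat
  proof -
    define T where "T = (\<Sum>\<^sub>\<infinity>n. (cmod (a n))\<^sup>2)"
    have "((\<lambda>F. \<Sum>n\<in>F. (cmod (a n))\<^sup>2) \<longlongrightarrow> T) (finite_subsets_at_top UNIV)"
      using has_sum_infsum [OF a] by (simp add: has_sum_def T_def)
    then have "\<forall>\<^sub>F F in finite_subsets_at_top UNIV. T - (1 / 4) ^ k < (\<Sum>n\<in>F. (cmod (a n))\<^sup>2)"
      by (rule order_tendstoD) simp
    then obtain E where E: "finite E" "T - (1 / 4) ^ k < (\<Sum>n\<in>E. (cmod (a n))\<^sup>2)"
      by (auto simp: eventually_finite_subsets_at_top)
    have "(\<Sum>n\<in>F. (cmod (a n))\<^sup>2) \<le> (1 / 4) ^ k" if F: "finite F" "F \<inter> E = {}" for F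
    proof -
      have "(\<Sum>n\<in>F. (cmod (a n))\<^sup>2) + (\<Sum>n\<in>E. (cmod (a n))\<^sup>2) = (\<Sum>n\<in>F \<union> E. (cmod (a n))\<^sup>2)"
        using F E by (simp add: sum.union_disjoint)
      also have "\<dots> \<le> T"
        unfolding T_def using F E by (intro finite_sum_le_infsum [OF a]) auto
      finally show ?thesis using E by simp
    qed
    with E show ?thesis by blast
  qed
  then obtain E where E: "\<And>k. finite (E k)"
    "\<And>k F. finite F \<Longrightarrow> F \<inter> E k = {} \<Longrightarrow> (\<Sum>n\<in>F. (cmod (a n))\<^sup>2) \<le> (1 / 4) ^ k"
    by metis
  \<comment> \<open>Taking unions makes the exceptional sets increasing, so the sums over them are
    comparable for \<open>k \<le> m\<close>.\<close>
  define D where "D k = (\<Union>i\<le>k. E i)" for k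
  have finD: "finite (D k)" for k
    by (simp add: D_def E)
  have tail: "(L2_norm (\<lambda>t. S F t - S (D k) t))\<^sup>2 \<le> B * (1 / 4) ^ k"
    if F: "finite F" "D k \<subseteq> F" for F k
  proof -
    have "(\<lambda>t. S F t - S (D k) t) = S (F - D k)"
      using F by (auto simp: S_def sum_diff fun_eq_iff)
    then have "(L2_norm (\<lambda>t. S F t - S (D k) t))\<^sup>2 \<le> B * (\<Sum>n\<in>F - D k. (cmod (a n))\<^sup>2)"
      using sb F by (simp add: S_def [abs_def] synthesis_bound_def)
    also have "\<dots> \<le> B * (1 / 4) ^ k"
      using F B by (intro mult_left_mono E) (auto simp: D_def)
    finally show ?thesis .
  qed
  have cauchy: "(L2_norm (\<lambda>t. S (D m) t - S (D k) t))\<^sup>2 \<le> B * (1 / 4) ^ k" if "k \<le> m" for k m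
    using that by (intro tail finD) (auto simp: D_def intro: order_trans)
  obtain s where s: "s \<in> L2" "\<And>k. (L2_norm (\<lambda>t. S (D k) t - s t))\<^sup>2 \<le> B * (1 / 4) ^ k"
    using L2_geometric_Cauchy_limit [where u="\<lambda>k. S (D k)" and C=B, OF S_mem [OF finD] cauchy]
    by blast
  \<comment> \<open>Both distances, from \<open>S F\<close> to \<open>S (D k)\<close> and from there
    to \<open>s\<close>, have square at most \<open>B * (1 / 4) ^ k\<close>; the doubled sum of the
    two gives \<open>4 * B\<close>.\<close>
  have near: "L2_norm (\<lambda>t. S F t - s t) \<le> sqrt (4 * B) * (1 / 2) ^ k"
    if F: "finite F" "D k \<subseteq> F" for F k
  proof -
    have "(L2_norm (\<lambda>t. S F t - s t))\<^sup>2 =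
        (L2_norm (\<lambda>t. (S F t - S (D k) t) + (S (D k) t - s t)))\<^sup>2"
      by simp
    also have "\<dots> \<le> 2 * (L2_norm (\<lambda>t. S F t - S (D k) t))\<^sup>2 + 2 * (L2_norm (\<lambda>t. S (D k) t - s t))\<^sup>2"
      using F finD s by (intro L2_norm_sq_add_le L2_diff S_mem) auto
    also have "\<dots> \<le> 4 * B * (1 / 4) ^ k"
      using tail [OF F] s(2) [of k] by simp
    also have "\<dots> = (sqrt (4 * B) * (1 / 2) ^ k)\<^sup>2"
    proof -
      have "((1 / 2 :: real) ^ k)\<^sup>2 = (1 / 4) ^ k"
        by (simp add: power2_eq_square flip: power_mult_distrib)
      then show ?thesis
        using B unfolding power_mult_distrib by simp
    qed
    finally show ?thesis
      by (rule power2_le_imp_le) (use B in auto)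
  qed
  have "((\<lambda>F. L2_norm (\<lambda>t. S F t - s t)) \<longlongrightarrow> 0) (finite_subsets_at_top UNIV)"
  proof (rule tendstoI)
    fix e :: real
    assume e: "e > 0"
    have "(\<lambda>k. sqrt (4 * B) * (1 / 2) ^ k) \<longlonglongrightarrow> sqrt (4 * B) * 0"
      by (intro tendsto_mult tendsto_const LIMSEQ_power_zero) simp
    then have "\<forall>\<^sub>F k in sequentially. sqrt (4 * B) * (1 / 2) ^ k < e"
      using e by (intro order_tendstoD) auto
    then obtain k where k: "sqrt (4 * B) * (1 / 2) ^ k < e"
      unfolding eventually_sequentially by blast
    show "\<forall>\<^sub>F F in finite_subsets_at_top UNIV. dist (L2_norm (\<lambda>t. S F t - s t)) 0 < e"
      unfolding eventually_finite_subsets_at_top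
    proof (intro exI [of _ "D k"] conjI allI impI)
      fix F
      assume "finite F \<and> D k \<subseteq> F \<and> F \<subseteq> UNIV"
      then show "dist (L2_norm (\<lambda>t. S F t - s t)) 0 < e"
        using near [of F k] k by simp
    qed (simp_all add: finD)
  qed
  then show thesis
    using that [of s] s by (simp add: L2_has_sum_def S_def)
qed

text \<open>Split \<open>s\<close> into \<open>s - S F\<close> and \<open>S F\<close> and let
  \<open>F\<close> grow: the first part vanishes, the second obeys the synthesis bound, and the
  factor 2 comes from the cruder form of the triangle inequality.\<close>

lemma synthesis_bound_sum_norm:
  assumes sb: "synthesis_bound B g" and s: "L2_has_sum (\<lambda>n t. a n * g n t) s"
    and M: "\<And>F. finite F \<Longrightarrow> (\<Sum>n\<in>F. (cmod (a n))\<^sup>2) \<le> M"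
  shows "(L2_norm s)\<^sup>2 \<le> 2 * B * M"
proof -
  have B: "B > 0" and g: "\<And>n. g n \<in> L2"
    using sb by (auto simp: synthesis_bound_def)
  define S where "S F t = (\<Sum>n\<in>F. a n * g n t)" for F t
  have sL: "s \<in> L2" and lim: "((\<lambda>F. L2_norm (\<lambda>t. S F t - s t)) \<longlongrightarrow> 0) (finite_subsets_at_top UNIV)"
    using s by (auto simp: L2_has_sum_def S_def)
  have le: "(L2_norm s)\<^sup>2 \<le> 2 * (L2_norm (\<lambda>t. S F t - s t))\<^sup>2 + 2 * B * M" if F: "finite F" for F
  proof -
    have SF: "S F \<in> L2"
      unfolding S_def [abs_def] using F g by (intro L2_sum_mem L2_scale)
    have "(L2_norm s)\<^sup>2 = (L2_norm (\<lambda>t. (s t - S F t) + S F t))\<^sup>2"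
      by simp
    also have "\<dots> \<le> 2 * (L2_norm (\<lambda>t. s t - S F t))\<^sup>2 + 2 * (L2_norm (S F))\<^sup>2"
      by (intro L2_norm_sq_add_le L2_diff sL SF)
    also have "(L2_norm (S F))\<^sup>2 \<le> B * (\<Sum>n\<in>F. (cmod (a n))\<^sup>2)"
      using sb F by (simp add: synthesis_bound_def S_def [abs_def])
    also have "\<dots> \<le> B * M"
      using M [OF F] B by simp
    finally show ?thesis
      by (simp add: L2_norm_minus_commute [of s])
  qed
  have "((\<lambda>F. 2 * (L2_norm (\<lambda>t. S F t - s t))\<^sup>2 + 2 * B * M) \<longlongrightarrow> 2 * 0\<^sup>2 + 2 * B * M)
      (finite_subsets_at_top UNIV)"
    by (intro tendsto_intros lim)
  then have "(L2_norm s)\<^sup>2 \<le> 2 * 0\<^sup>2 + 2 * B * M"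
    by (rule tendsto_lowerbound)
      (auto intro!: le eventually_finite_subsets_at_top_weakI)
  then show ?thesis by simp
qed


subsection \<open>Dilations\<close>

text \<open>The unitary dilation by \<open>2 powi j\<close>, conjugated by multiplication with the
  chirp of exponent \<open>(\<i> / 2) * t^2 * cot \<alpha>\<close>.\<close>

definition chirp_dilation :: "real \<Rightarrow> int \<Rightarrow> (real \<Rightarrow> complex) \<Rightarrow> real \<Rightarrow> complex" where
  "chirp_dilation \<alpha> j h t =
     of_real (2 powr (of_int j / 2)) * h (2 powi j * t) *
     exp (- (\<i> / 2) * of_real ((t\<^sup>2 - (2 powi j * t)\<^sup>2) * cot \<alpha>))"

lemma cmod_chirp: "cmod (exp (- (\<i> / 2) * of_real x)) = 1"
  by (simp add: norm_exp_eq_Re)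

lemma chirp_dilation_cmod_sq:
  "(cmod (chirp_dilation \<alpha> j h t))\<^sup>2 = 2 powi j * (cmod (h (2 powi j * t)))\<^sup>2"
proof -
  have "(2 powr (real_of_int j / 2))\<^sup>2 = 2 powr real_of_int j"
    by (simp add: power2_eq_square flip: powr_add)
  then show ?thesis
    unfolding chirp_dilation_def norm_mult cmod_chirp
    by (simp add: power_mult_distrib powr_real_of_int')
qed

text \<open>The chirp is unimodular, and the squared normalising factor is the Jacobian of the
  substitution of \<open>2 powi j * t\<close> for \<open>t\<close>.\<close>

lemma chirp_dilation_L2:
  assumes h: "h \<in> L2"
  shows "chirp_dilation \<alpha> j h \<in> L2"
    and "L2_norm (chirp_dilation \<alpha> j h) = L2_norm h"
proof -
  note [measurable] = L2_measurable [OF h]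
  have pos: "(2::real) powi j > 0"
    by simp
  have "integrable lborel (\<lambda>t. (cmod (h (0 + 2 powi j * t)))\<^sup>2)"
    using L2_integrable [OF h] pos by (subst lborel_integrable_real_affine_iff) auto
  moreover have "chirp_dilation \<alpha> j h \<in> borel_measurable borel"
    unfolding chirp_dilation_def [abs_def] by measurable
  ultimately show "chirp_dilation \<alpha> j h \<in> L2"
    by (simp add: L2_def chirp_dilation_cmod_sq)
  show "L2_norm (chirp_dilation \<alpha> j h) = L2_norm h"
    unfolding L2_norm_def chirp_dilation_cmod_sq
    using lborel_integral_real_affine [of "2 powi j" "\<lambda>t. (cmod (h t))\<^sup>2" 0] pos by simp
qed

lemma chirp_dilation_sum:
  "chirp_dilation \<alpha> j (\<lambda>t. \<Sum>n\<in>F. a n * h n t) t = (\<Sum>n\<in>F. a n * chirp_dilation \<alpha> j (h n) t)"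
  unfolding chirp_dilation_def sum_distrib_left sum_distrib_right
  by (intro sum.cong refl) (simp only: mult_ac)

text \<open>With \<open>x = 2 powi j * t\<close>, the scale-0 exponent evaluated at \<open>x\<close>
  and the chirp exponent add up to the scale-\<open>j\<close> exponent except for a term free of
  \<open>t\<close>. That term is a unimodular constant depending on \<open>n\<close>.\<close>

lemma frac_wavelet_eq_chirp_dilation:
  "frac_wavelet \<alpha> f j n t =
     exp (- (\<i> / 2) * of_real (((of_int n)\<^sup>2 - (2 powi (- j) * of_int n)\<^sup>2) * cot \<alpha>)) *
     chirp_dilation \<alpha> j (frac_wavelet \<alpha> f 0 n) t"
proof -
  define x c where "x = 2 powi j * t" and "c = cot \<alpha>"
  define y where "y = 2 powi (- j) * real_of_int n"
  have "exp (- (\<i> / 2) * of_real ((t\<^sup>2 - y\<^sup>2 - (x - of_int n)\<^sup>2) * c)) =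
      exp (- (\<i> / 2) * of_real (((of_int n)\<^sup>2 - y\<^sup>2) * c)) *
      (exp (- (\<i> / 2) * of_real ((x\<^sup>2 - (of_int n)\<^sup>2 - (x - of_int n)\<^sup>2) * c)) *
      exp (- (\<i> / 2) * of_real ((t\<^sup>2 - x\<^sup>2) * c)))"
    unfolding exp_add [symmetric] by (rule arg_cong [where f=exp]) (simp add: algebra_simps)
  then show ?thesis
    by (simp add: frac_wavelet_def chirp_dilation_def flip: x_def c_def y_def)
qed

text \<open>The unimodular constants are moved into the coefficients, whose moduli they preserve,
  and the dilation preserves norms. Hence \<open>B\<close> is independent of \<open>j\<close>, the
  source of the uniformity.\<close>

lemma frac_wavelet_synthesis_bound:
  assumes sb: "synthesis_bound B (\<lambda>n. frac_wavelet \<alpha> f 0 n)"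
  shows "synthesis_bound B (\<lambda>n. frac_wavelet \<alpha> f j n)"
proof -
  let ?c = "\<lambda>n. exp (- (\<i> / 2) * of_real (((of_int n)\<^sup>2 - (2 powi (- j) * of_int n)\<^sup>2) * cot \<alpha>))"
  have mem: "frac_wavelet \<alpha> f 0 n \<in> L2" for n
    using sb by (simp add: synthesis_bound_def)
  have "(\<lambda>t. ?c n * chirp_dilation \<alpha> j (frac_wavelet \<alpha> f 0 n) t) \<in> L2" for n
    by (intro L2_scale chirp_dilation_L2 mem)
  then have mem': "frac_wavelet \<alpha> f j n \<in> L2" for n
    by (simp only: flip: frac_wavelet_eq_chirp_dilation)
  have "(L2_norm (\<lambda>t. \<Sum>n\<in>F. a n * frac_wavelet \<alpha> f j n t))\<^sup>2 \<le> B * (\<Sum>n\<in>F. (cmod (a n))\<^sup>2)"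
    if F: "finite F" for F a
  proof -
    have h: "(\<lambda>t. \<Sum>n\<in>F. (a n * ?c n) * frac_wavelet \<alpha> f 0 n t) \<in> L2"
      by (intro L2_sum_mem L2_scale F mem)
    have "(\<lambda>t. \<Sum>n\<in>F. a n * frac_wavelet \<alpha> f j n t) =
        chirp_dilation \<alpha> j (\<lambda>t. \<Sum>n\<in>F. (a n * ?c n) * frac_wavelet \<alpha> f 0 n t)"
      unfolding frac_wavelet_eq_chirp_dilation [of _ _ j]
      by (rule ext, simp only: chirp_dilation_sum) (simp only: mult.assoc)
    from arg_cong [where f=L2_norm, OF this]
    have "L2_norm (\<lambda>t. \<Sum>n\<in>F. a n * frac_wavelet \<alpha> f j n t) =
        L2_norm (\<lambda>t. \<Sum>n\<in>F. (a n * ?c n) * frac_wavelet \<alpha> f 0 n t)"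
      unfolding chirp_dilation_L2(2) [OF h] .
    also have "\<dots>\<^sup>2 \<le> B * (\<Sum>n\<in>F. (cmod (a n * ?c n))\<^sup>2)"
      by (rule synthesis_bound_le [OF sb F])
    finally show ?thesis
      by (simp only: norm_mult cmod_chirp mult_1_right)
  qed
  with sb mem' show ?thesis
    by (simp add: synthesis_bound_def)
qed

section \<open>Convergence and uniform boundedness of the operators\<close>

lemma frac_proj_bounded:
  assumes sb: "synthesis_bound B (\<lambda>n. frac_wavelet \<alpha> \<phi> 0 n)"
    and sb': "synthesis_bound B' (\<lambda>n. frac_wavelet \<alpha> \<phi>' 0 n)"
    and f: "f \<in> L2"
  shows "L2_has_sum (frac_proj_term \<alpha> \<phi> \<phi>' j f) (frac_proj \<alpha> \<phi> \<phi>' j f)"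
    and "L2_norm (frac_proj \<alpha> \<phi> \<phi>' j f) \<le> sqrt (2 * B * B') * L2_norm f"
proof -
  define a where "a k = L2_inner f (frac_wavelet \<alpha> \<phi>' j k)" for k
  have M: "(\<Sum>k\<in>F. (cmod (a k))\<^sup>2) \<le> B' * (L2_norm f)\<^sup>2" if "finite F" for F
    unfolding a_def
    by (rule synthesis_bound_analysis [OF frac_wavelet_synthesis_bound [OF sb'] f that])
  have sm: "(\<lambda>k. (cmod (a k))\<^sup>2) summable_on UNIV"
    by (rule nonneg_bounded_partial_sums_imp_summable_on)
      (auto intro!: M eventually_finite_subsets_at_top_weakI)
  have term_eq: "frac_proj_term \<alpha> \<phi> \<phi>' j f = (\<lambda>k t. a k * frac_wavelet \<alpha> \<phi> j k t)"
    by (simp add: fun_eq_iff frac_proj_term_def a_def)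
  \<comment> \<open>\<open>L2_sum\<close> is a choice, so exhibiting some sum is what makes the
    chosen function a sum as well.\<close>
  show *: "L2_has_sum (frac_proj_term \<alpha> \<phi> \<phi>' j f) (frac_proj \<alpha> \<phi> \<phi>' j f)"
    unfolding frac_proj_def L2_sum_def term_eq
    using synthesis_bound_has_sum [OF frac_wavelet_synthesis_bound [OF sb] sm] by (metis someI_ex)
  \<comment> \<open>Analysis against \<open>\<phi>'\<close> costs \<open>B'\<close>, and synthesis
    with \<open>\<phi>\<close> costs \<open>2 * B\<close>.\<close>
  have "(L2_norm (frac_proj \<alpha> \<phi> \<phi>' j f))\<^sup>2 \<le> 2 * B * (B' * (L2_norm f)\<^sup>2)"
    using * M unfolding term_eq
    by (rule synthesis_bound_sum_norm [OF frac_wavelet_synthesis_bound [OF sb]])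
  also have "\<dots> = (sqrt (2 * B * B') * L2_norm f)\<^sup>2"
    using sb sb' by (simp add: power_mult_distrib synthesis_bound_def)
  finally show "L2_norm (frac_proj \<alpha> \<phi> \<phi>' j f) \<le> sqrt (2 * B * B') * L2_norm f"
    by (rule power2_le_imp_le) (use sb sb' in \<open>auto simp: synthesis_bound_def\<close>)
qed

theorem lemma4p7:
  fixes \<alpha> :: real
    and V V' :: "int \<Rightarrow> (real \<Rightarrow> complex) set"
    and \<phi> \<phi>' :: "real \<Rightarrow> complex"
  assumes "sin \<alpha> > 0"
    and "dual_fractional_MRAs \<alpha> V \<phi> V' \<phi>'"
  shows "\<exists>C>0. \<forall>j. \<forall>f\<in>L2.
           L2_has_sum (frac_proj_term \<alpha> \<phi> \<phi>' j f) (frac_proj \<alpha> \<phi> \<phi>' j f) \<and>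
           L2_has_sum (frac_proj_term \<alpha> \<phi>' \<phi> j f) (frac_proj \<alpha> \<phi>' \<phi> j f) \<and>
           L2_norm (frac_proj \<alpha> \<phi> \<phi>' j f) \<le> C * L2_norm f \<and>
           L2_norm (frac_proj \<alpha> \<phi>' \<phi> j f) \<le> C * L2_norm f"
proof -
  have "\<exists>B. synthesis_bound B (\<lambda>n. frac_wavelet \<alpha> f 0 n)" if "fractional_MRA \<alpha> W f" for W f
    using that Riesz_basis_synthesis_bound unfolding fractional_MRA_def by metis
  then obtain B B' where sb: "synthesis_bound B (\<lambda>n. frac_wavelet \<alpha> \<phi> 0 n)"
    "synthesis_bound B' (\<lambda>n. frac_wavelet \<alpha> \<phi>' 0 n)"
    using assms(2) unfolding dual_fractional_MRAs_def by meson
  then have "sqrt (2 * B * B') > 0"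
    by (simp add: synthesis_bound_def)
  \<comment> \<open>The constant is symmetric in \<open>B\<close> and \<open>B'\<close>, so it also
    serves the operator with the scaling functions exchanged.\<close>
  then show ?thesis
    using frac_proj_bounded [OF sb] frac_proj_bounded [OF sb(2) sb(1)]
    by (intro exI [of _ "sqrt (2 * B * B')"]) (simp add: mult_ac)
qed

end
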